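(* Let $\Bbbk$ be an algebraically closed field, $n\ge1$, and let $B\subset GL(n)$ be the Borel subgroup of invertible lower triangular $n\times n$ matrices over $\Bbbk$. Let $C=(c_{i,j})$ be the upper triangular $n\times n$ matrix with $c_{i,j}=1$ for all $i\le j$ and $c_{i,j}=0$ for $i>j$. For $A\in B$ put $D=AC$ and, for $1\le i\le n$, let $D_i$ be the upper left $i\times i$ block of $D$. Then the map $$\Pi:B\longrightarrow\Bbbk^{\frac{n(n-1)}2}\times(\Bbbk^* )^n,\qquad \Pi(A)=\big(P^{(i)}_1(D_i),\dots,P^{(i)}_i(D_i)\big)_{i=1,\dots,n},$$ is an isomorphism of varieties.
   Context: For an $i\times i$ matrix $X$, $P_1^{(i)}(X),\dots,P_i^{(i)}(X)$ are the coefficients of its characteristic polynomial, indexed so that $P^{(i)}_h$ is homogeneous of degree $h$ in the entries of $X$, normalized as the sum of all $h\times h$ principal minors; in particular $P^{(i)}_i=\det$. Thus for each $i$ the tuple $(P_1^{(i)}(D_i),\dots,P_i^{(i)}(D_i))$ lies in $\Bbbk^{i-1}\times\Bbbk^*$, and the product of these targets over $i=1,\dots,n$ is $\Bbbk^{n(n-1)/2}\times(\Bbbk^* )^n$. *)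

theory Defs
  imports
    "HOL-Analysis.Abstract_Topology"
    "HOL-Library.FuncSet"
    "Jordan_Normal_Form.Char_Poly"
    "Jordan_Normal_Form.DL_Submatrix"
begin

section \<open>Embedded varieties and their morphisms\<close>

text \<open>
  An affine space is presented by its points, of some type \<open>'p\<close>, and a set \<open>F\<close> of coordinate
  functions \<open>'p \<Rightarrow> 'k\<close>; this allows affine spaces of matrices and of tuples alike. A variety is a
  locally closed subset of an affine space with the induced topology and sheaf of regular functions.
  Polynomials are represented by the functions they induce, which is harmless over the infinite
  fields considered here.
\<close>

inductive_set polyfuns :: "('p \<Rightarrow> 'k::field) set \<Rightarrow> ('p \<Rightarrow> 'k) set" for F where
  const: "(\<lambda>_. c) \<in> polyfuns F"
| coord: "f \<in> F \<Longrightarrow> f \<in> polyfuns F"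
| add: "f \<in> polyfuns F \<Longrightarrow> g \<in> polyfuns F \<Longrightarrow> (\<lambda>x. f x + g x) \<in> polyfuns F"
| mult: "f \<in> polyfuns F \<Longrightarrow> g \<in> polyfuns F \<Longrightarrow> (\<lambda>x. f x * g x) \<in> polyfuns F"

definition zariski :: "('p \<Rightarrow> 'k::field) set \<Rightarrow> 'p set \<Rightarrow> 'p topology" where
  "zariski F X = topology (\<lambda>U. \<exists>S \<subseteq> polyfuns F. U = {x \<in> X. \<exists>f\<in>S. f x \<noteq> 0})"

lemma openin_zariski:
  "openin (zariski F X) U \<longleftrightarrow> (\<exists>S \<subseteq> polyfuns F. U = {x \<in> X. \<exists>f\<in>S. f x \<noteq> 0})"
proof -
  let ?D = "\<lambda>S. {x \<in> X. \<exists>f\<in>S. f x \<noteq> 0}"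
  let ?O = "\<lambda>U. \<exists>S \<subseteq> polyfuns F. U = ?D S"
  have "?O (U \<inter> V)" if U: "?O U" and V: "?O V" for U V
  proof -
    obtain S where S: "S \<subseteq> polyfuns F" "U = ?D S" using U by (elim exE conjE)
    obtain T where T: "T \<subseteq> polyfuns F" "V = ?D T" using V by (elim exE conjE)
    let ?R = "(\<lambda>(f, g) x. f x * g x) ` (S \<times> T)"
    have "?R \<subseteq> polyfuns F" using S(1) T(1) by (auto intro: polyfuns.mult)
    moreover have "U \<inter> V = ?D ?R"
      unfolding S(2) T(2) by auto
    ultimately show ?thesis by (intro exI[of _ ?R] conjI)
  qed
  moreover have "?O (\<Union>\<K>)" if K: "\<forall>K\<in>\<K>. ?O K" for \<K>
  proof -
    obtain S where S: "\<forall>K\<in>\<K>. S K \<subseteq> polyfuns F \<and> K = ?D (S K)"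
      using bchoice[OF K] by (elim exE)
    have "\<Union>\<K> = (\<Union>K\<in>\<K>. ?D (S K))" using S by auto
    also have "\<dots> = ?D (\<Union>K\<in>\<K>. S K)" by auto
    finally show ?thesis using S by (intro exI[of _ "\<Union>K\<in>\<K>. S K"] conjI) auto
  qed
  ultimately have "istopology ?O" unfolding istopology_def by (intro conjI allI impI)
  then show ?thesis by (simp add: zariski_def)
qed

lemma topspace_zariski [simp]: "topspace (zariski F X) = X"
proof -
  have "openin (zariski F X) X"
    unfolding openin_zariski
    by (intro exI[of _ "{\<lambda>_. 1}"]) (auto intro: polyfuns.const)
  moreover have "U \<subseteq> X" if "openin (zariski F X) U" for U
    using that unfolding openin_zariski by blast
  ultimately show ?thesis
    using openin_subset by (auto simp: topspace_def)
qed

definition quasi_affine :: "('p \<Rightarrow> 'k::field) set \<Rightarrow> 'p set \<Rightarrow> 'p set \<Rightarrow> bool" where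
  "quasi_affine F E X \<longleftrightarrow>
     (\<exists>U Z. openin (zariski F E) U \<and> closedin (zariski F E) Z \<and> X = U \<inter> Z)"

definition regular_on :: "('p \<Rightarrow> 'k::field) set \<Rightarrow> 'p set \<Rightarrow> 'p set \<Rightarrow> ('p \<Rightarrow> 'k) \<Rightarrow> bool" where
  "regular_on F X U f \<longleftrightarrow>
     (\<forall>p\<in>U. \<exists>V g h. openin (zariski F X) V \<and> p \<in> V \<and> V \<subseteq> U \<and> g \<in> polyfuns F \<and> h \<in> polyfuns F \<and>
        (\<forall>x\<in>V. h x \<noteq> 0 \<and> f x = g x / h x))"

definition variety_morphism ::
  "('p \<Rightarrow> 'k::field) set \<Rightarrow> 'p set \<Rightarrow> ('q \<Rightarrow> 'k) set \<Rightarrow> 'q set \<Rightarrow> ('p \<Rightarrow> 'q) \<Rightarrow> bool" where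
  "variety_morphism F X G Y \<phi> \<longleftrightarrow>
     continuous_map (zariski F X) (zariski G Y) \<phi> \<and>
     (\<forall>V f. openin (zariski G Y) V \<longrightarrow> regular_on G Y V f \<longrightarrow>
        regular_on F X {x \<in> X. \<phi> x \<in> V} (f \<circ> \<phi>))"

definition variety_isomorphism ::
  "('p \<Rightarrow> 'k::field) set \<Rightarrow> 'p set \<Rightarrow> ('q \<Rightarrow> 'k) set \<Rightarrow> 'q set \<Rightarrow> ('p \<Rightarrow> 'q) \<Rightarrow> bool" where
  "variety_isomorphism F X G Y \<phi> \<longleftrightarrow>
     variety_morphism F X G Y \<phi> \<and>
     (\<exists>\<psi>. variety_morphism G Y F X \<psi> \<and> (\<forall>x\<in>X. \<psi> (\<phi> x) = x) \<and> (\<forall>y\<in>Y. \<phi> (\<psi> y) = y))"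


section \<open>The Borel subgroup, the target and the map\<close>

definition mat_coords :: "nat \<Rightarrow> ('k mat \<Rightarrow> 'k) set" where
  "mat_coords n = {(\<lambda>A. A $$ (i, j)) | i j. i < n \<and> j < n}"

definition borel_subgroup :: "nat \<Rightarrow> 'k::field mat set" where
  "borel_subgroup n = {A \<in> carrier_mat n n. invertible_mat A \<and> upper_triangular (transpose_mat A)}"

definition C_mat :: "nat \<Rightarrow> 'k::field mat" where
  "C_mat n = mat n n (\<lambda>(i, j). if i \<le> j then 1 else 0)"

definition upper_left_block :: "'k mat \<Rightarrow> nat \<Rightarrow> 'k mat" where
  "upper_left_block D i = submatrix D {..<i} {..<i}"

definition P_coeff :: "nat \<Rightarrow> 'k::comm_ring_1 mat \<Rightarrow> 'k" where
  "P_coeff h X = (\<Sum>S | S \<subseteq> {..<dim_row X} \<and> card S = h. det (submatrix X S S))"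

definition index_set :: "nat \<Rightarrow> (nat \<times> nat) set" where
  "index_set n = (SIGMA i:{1..n}. {1..i})"

text \<open>
  The product over \<open>i = 1, \<dots>, n\<close> of the spaces of tuples indexed by \<open>h = 1, \<dots>, i\<close> whose last
  entry is nonzero.
\<close>

definition target_space :: "nat \<Rightarrow> (nat \<times> nat \<Rightarrow> 'k::field) set" where
  "target_space n = (\<Pi>\<^sub>E (i, h)\<in>index_set n. if h = i then UNIV - {0} else UNIV)"

definition tuple_coords :: "'i set \<Rightarrow> (('i \<Rightarrow> 'k) \<Rightarrow> 'k) set" where
  "tuple_coords I = {(\<lambda>x. x c) | c. c \<in> I}"

definition Pi_map :: "nat \<Rightarrow> 'k::field mat \<Rightarrow> nat \<times> nat \<Rightarrow> 'k" where
  "Pi_map n A = (\<lambda>(i, h)\<in>index_set n. P_coeff h (upper_left_block (A * C_mat n) i))"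


section \<open>Consistency of the definitions\<close>

lemma upper_left_block_eq:
  assumes "D \<in> carrier_mat n n" "i \<le> n"
  shows "upper_left_block D i = mat i i (\<lambda>(r, c). D $$ (r, c))"
proof -
  have *: "{r. r < n \<and> r < i} = {..<i}" using assms by auto
  have p: "pick {..<i} r = r" if "r < i" for r
    using pick_card_in_set[of r "{..<i}"] that
    by (metis (no_types, lifting) Collect_cong card_Collect_less_nat lessThan_iff order.strict_trans)
  show ?thesis
    using assms by (intro eq_matI) (auto simp: upper_left_block_def submatrix_def * p)
qed

lemma det_submatrix_eq:
  fixes X :: "'k::comm_ring_1 mat"
  assumes X: "X \<in> carrier_mat n n" and S: "S \<subseteq> {..<n}"
  shows "det (submatrix X S S) = (\<Sum>p | p permutes S. signof p * (\<Prod>i\<in>S. X $$ (i, p i)))"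
proof -
  let ?m = "card S" and ?f = "pick S"
  have fin: "finite S" using S finite_subset by blast
  have dims: "{i. i < n \<and> i \<in> S} = S" using S by auto
  have inj: "inj_on ?f {0..<?m}"
    by (rule linorder_inj_onI) (auto dest: pick_mono_le)
  have bij: "bij_betw ?f {0..<?m} S"
  proof (rule bij_betw_imageI[OF inj])
    have "?f ` {0..<?m} \<subseteq> S" by (auto intro: pick_in_set_le)
    moreover have "card (?f ` {0..<?m}) = card S" using card_image[OF inj] by simp
    ultimately show "?f ` {0..<?m} = S" using fin card_subset_eq by blast
  qed
  have sub: "submatrix X S S = mat ?m ?m (\<lambda>(i, j). X $$ (?f i, ?f j))"
    using X unfolding submatrix_def by (simp add: dims)
  let ?M = "map_permutation {0..<?m} ?f"
  let ?g = "inv_into {0..<?m} ?f"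
  have bij': "bij_betw ?g S {0..<?m}" using bij by (rule bij_betw_inv_into)
  have "(\<Sum>p | p permutes S. signof p * (\<Prod>i\<in>S. X $$ (i, p i))) =
        (\<Sum>p | p permutes {0..<?m}. signof (?M p) * (\<Prod>i\<in>S. X $$ (i, ?M p i)))"
  proof (rule sum.reindex_bij_witness[of _ ?M "map_permutation S ?g"])
    fix p assume p: "p \<in> {p. p permutes S}"
    show 1: "?M (map_permutation S ?g p) = p"
      using bij p by (intro map_permutation_compose_inv[OF bij'])
        (auto simp: bij_betw_def f_inv_into_f)
    show "map_permutation S ?g p \<in> {p. p permutes {0..<?m}}"
      using p bij' by (auto intro: map_permutation_permutes)
    show "signof (?M (map_permutation S ?g p)) *
      (\<Prod>i\<in>S. X $$ (i, ?M (map_permutation S ?g p) i)) = signof p * (\<Prod>i\<in>S. X $$ (i, p i))"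
      by (simp only: 1)
  next
    fix p assume p: "p \<in> {p. p permutes {0..<?m}}"
    show "map_permutation S ?g (?M p) = p"
      using inj p by (intro map_permutation_compose_inv[OF bij]) auto
    show "?M p \<in> {p. p permutes S}"
      using p bij by (auto intro: map_permutation_permutes)
  qed
  also have "\<dots> = (\<Sum>p | p permutes {0..<?m}. signof p *
      (\<Prod>i = 0..<?m. submatrix X S S $$ (i, p i)))"
  proof (rule sum.cong[OF refl])
    fix p assume p: "p \<in> {p. p permutes {0..<?m}}"
    have "sign (?M p) = sign p"
      using p inj by (intro sign_map_permutation) auto
    moreover have "(\<Prod>i\<in>S. X $$ (i, ?M p i)) = (\<Prod>i = 0..<?m. X $$ (?f i, ?M p (?f i)))"
      by (rule prod.reindex_bij_betw[OF bij, symmetric])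
    moreover have "\<dots> = (\<Prod>i = 0..<?m. submatrix X S S $$ (i, p i))"
    proof (rule prod.cong[OF refl])
      fix i assume i: "i \<in> {0..<?m}"
      then have "p i < ?m" using p permutes_in_image[of p "{0..<?m}" i] by simp
      then show "X $$ (?f i, ?M p (?f i)) = submatrix X S S $$ (i, p i)"
        using i by (simp add: sub map_permutation_apply[OF inj])
    qed
    ultimately show "signof (?M p) * (\<Prod>i\<in>S. X $$ (i, ?M p i)) =
      signof p * (\<Prod>i = 0..<?m. submatrix X S S $$ (i, p i))" by simp
  qed
  also have "\<dots> = det (submatrix X S S)"
    by (rule det_def'[symmetric]) (simp add: sub)
  finally show ?thesis ..
qed

lemma P_coeff_char_poly:
  fixes X :: "'k::comm_ring_1 mat"
  assumes X: "X \<in> carrier_mat n n" and h: "h \<le> n"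
  shows "coeff (char_poly X) (n - h) = (-1) ^ h * P_coeff h X"
proof -
  let ?N = "{0..<n}" and ?x = "[:0, 1:] :: 'k poly"
  let ?a = "\<lambda>p i. [:- (X $$ (i, p i)):]" and ?d = "\<lambda>p i. if i = p i then ?x else 0"
  let ?t = "\<lambda>p S. signof p * ((\<Prod>i\<in>S. ?a p i) * (\<Prod>i\<in>?N - S. ?d p i))"
  have "char_poly X = (\<Sum>p | p permutes ?N. signof p * (\<Prod>i\<in>?N. char_poly_matrix X $$ (i, p i)))"
    unfolding char_poly_def by (rule det_def') (use X in simp)
  also have "\<dots> = (\<Sum>p | p permutes ?N. signof p * (\<Prod>i\<in>?N. ?a p i + ?d p i))"
  proof (intro sum.cong refl arg_cong2[where f="(*)"] prod.cong)
    fix p i assume "p \<in> {p. p permutes ?N}" and i: "i \<in> ?N"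
    then have "p i < n" using permutes_in_image[of p ?N i] by simp
    then show "char_poly_matrix X $$ (i, p i) = ?a p i + ?d p i"
      using i X by (auto simp: char_poly_matrix_def)
  qed
  also have "\<dots> = (\<Sum>p | p permutes ?N. \<Sum>S\<in>Pow ?N. ?t p S)"
    by (simp add: prod_add sum_distrib_left)
  also have "\<dots> = (\<Sum>S\<in>Pow ?N. \<Sum>p | p permutes ?N. ?t p S)"
    by (rule sum.swap)
  also have "\<dots> = (\<Sum>S\<in>Pow ?N. monom ((-1) ^ card S * det (submatrix X S S)) (n - card S))"
  proof (rule sum.cong[OF refl])
    fix S assume "S \<in> Pow ?N"
    then have S: "S \<subseteq> ?N" and fin: "finite S" using finite_subset by auto
    have "(\<Sum>p | p permutes ?N. ?t p S) = (\<Sum>p | p permutes S. ?t p S)"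
    proof (rule sum.mono_neutral_right)
      show "finite {p. p permutes ?N}" by (simp add: finite_permutations)
      show "{p. p permutes S} \<subseteq> {p. p permutes ?N}" using S permutes_subset by blast
      show "\<forall>p\<in>{p. p permutes ?N} - {p. p permutes S}. ?t p S = 0"
      proof
        fix p assume p: "p \<in> {p. p permutes ?N} - {p. p permutes S}"
        then have "\<exists>i\<in>?N - S. i \<noteq> p i"
          by (metis Diff_iff mem_Collect_eq permutes_superset)
        then have "(\<Prod>i\<in>?N - S. ?d p i) = 0"
          by (intro prod_zero) force+
        then show "?t p S = 0" by simp
      qed
    qed
    also have "\<dots> = (\<Sum>p | p permutes S.
        monom ((-1) ^ card S * (signof p * (\<Prod>i\<in>S. X $$ (i, p i)))) (n - card S))"
    proof (rule sum.cong[OF refl])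
      fix p assume p: "p \<in> {p. p permutes S}"
      have "(\<Prod>i\<in>?N - S. ?d p i) = (\<Prod>i\<in>?N - S. ?x)"
        using p by (intro prod.cong) (auto simp: permutes_not_in)
      also have "\<dots> = monom 1 (n - card S)"
        using S fin by (simp add: card_Diff_subset monom_altdef)
      finally have 1: "(\<Prod>i\<in>?N - S. ?d p i) = monom 1 (n - card S)" .
      have "(\<Prod>i\<in>S. ?a p i) = [:\<Prod>i\<in>S. - (X $$ (i, p i)):]"
        using fin by (induction S rule: finite_induct) (auto simp: one_pCons)
      also have "(\<Prod>i\<in>S. - (X $$ (i, p i))) = (-1) ^ card S * (\<Prod>i\<in>S. X $$ (i, p i))"
        using fin by (induction S rule: finite_induct) auto
      finally have 2: "(\<Prod>i\<in>S. ?a p i) = [:(-1) ^ card S * (\<Prod>i\<in>S. X $$ (i, p i)):]" .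
      show "?t p S = monom ((-1) ^ card S * (signof p * (\<Prod>i\<in>S. X $$ (i, p i)))) (n - card S)"
        unfolding 1 2 by (cases p rule: sign_cases) (simp_all add: smult_monom minus_monom)
    qed
    also have "\<dots> = monom ((-1) ^ card S * det (submatrix X S S)) (n - card S)"
      using S unfolding monom_hom.hom_sum[symmetric] sum_distrib_left[symmetric]
      by (subst det_submatrix_eq[OF X]) (auto simp: sum_distrib_left)
    finally show "(\<Sum>p | p permutes ?N. ?t p S) = \<dots>" .
  qed
  finally have "coeff (char_poly X) (n - h) =
    (\<Sum>S\<in>Pow ?N. if n - card S = n - h then (-1) ^ card S * det (submatrix X S S) else 0)"
    by (simp add: coeff_sum)
  also have "\<dots> = (\<Sum>S\<in>Pow ?N. if card S = h then (-1) ^ h * det (submatrix X S S) else 0)"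
  proof (intro sum.cong refl)
    fix S assume "S \<in> Pow ?N"
    then have "card S \<le> n" using card_mono[of ?N S] by simp
    then have "n - card S = n - h \<longleftrightarrow> card S = h" using h by auto
    then show "(if n - card S = n - h then (-1) ^ card S * det (submatrix X S S) else 0) =
      (if card S = h then (-1) ^ h * det (submatrix X S S) else 0)" by auto
  qed
  also have "\<dots> = (\<Sum>S\<in>{S \<in> Pow ?N. card S = h}. (-1) ^ h * det (submatrix X S S))"
    by (rule sum.inter_filter[symmetric]) simp
  also have "{S \<in> Pow ?N. card S = h} = {S. S \<subseteq> {..<dim_row X} \<and> card S = h}"
    using X by (auto simp: lessThan_atLeast0)
  finally show ?thesis by (simp add: P_coeff_def sum_distrib_left)
qed

lemma P_coeff_det:
  fixes X :: "'k::comm_ring_1 mat"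
  assumes X: "X \<in> carrier_mat n n"
  shows "P_coeff n X = det X"
proof -
  have "{S. S \<subseteq> {..<dim_row X} \<and> card S = n} = {{..<n}}"
    using X card_subset_eq[of "{..<n}"] by auto
  moreover have "submatrix X {..<n} {..<n} = X"
    using upper_left_block_eq[OF X order_refl] X
    by (auto simp: upper_left_block_def intro!: eq_matI)
  ultimately show ?thesis by (simp add: P_coeff_def)
qed

lemma polyfuns_prod:
  assumes "finite S" "\<And>s. s \<in> S \<Longrightarrow> f s \<in> polyfuns F"
  shows "(\<lambda>x. \<Prod>s\<in>S. f s x) \<in> polyfuns F"
  using assms by (induction S rule: finite_induct) (auto intro: polyfuns.intros)

lemma borel_subgroup_altdef:
  "(borel_subgroup n :: 'k::field mat set) =
     {A \<in> carrier_mat n n. (\<forall>j<n. \<forall>i<j. A $$ (i, j) = 0) \<and> (\<Prod>i<n. A $$ (i, i)) \<noteq> 0}"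
proof -
  have "invertible_mat A \<longleftrightarrow> (\<Prod>i<n. A $$ (i, i)) \<noteq> 0"
    if A: "A \<in> carrier_mat n n" and low: "\<forall>j<n. \<forall>i<j. A $$ (i, j) = 0" for A :: "'k mat"
  proof -
    have "det A = prod_list (diag_mat A)"
      using low A by (intro det_lower_triangular) auto
    also have "\<dots> = (\<Prod>i<n. A $$ (i, i))"
      using A by (simp add: prod_list_diag_prod lessThan_atLeast0)
    finally have d: "det A = (\<Prod>i<n. A $$ (i, i))" .
    have "invertible_mat A" if "det A \<noteq> 0"
    proof -
      from det_non_zero_imp_unit[OF A that, of "()"] obtain B
        where "B \<in> carrier_mat n n" "B * A = 1\<^sub>m n" "A * B = 1\<^sub>m n"
        by (auto simp: Units_def ring_mat_def)
      then show ?thesis using A unfolding invertible_mat_def inverts_mat_def by auto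
    qed
    moreover have "det A \<noteq> 0" if inv: "invertible_mat A"
    proof -
      obtain B where B: "A * B = 1\<^sub>m n" "B * A = 1\<^sub>m (dim_row B)"
        using inv A unfolding invertible_mat_def inverts_mat_def by auto
      have "dim_col B = n" using arg_cong[OF B(1), of dim_col] by simp
      moreover have "dim_row B = n" using arg_cong[OF B(2), of dim_col] A by simp
      ultimately have "B \<in> carrier_mat n n" by auto
      then have "det A * det B = 1" using det_mult[OF A] B(1) by fastforce
      then show ?thesis by auto
    qed
    ultimately show ?thesis using d by auto
  qed
  then show ?thesis
    unfolding borel_subgroup_def upper_triangular_def by fastforce
qed

lemma quasi_affine_borel_subgroup:
  "quasi_affine (mat_coords n) (carrier_mat n n) (borel_subgroup n :: 'k::field mat set)"
proof -
  let ?F = "mat_coords n :: ('k mat \<Rightarrow> 'k) set" and ?E = "carrier_mat n n :: 'k mat set"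
  let ?d = "\<lambda>A :: 'k mat. \<Prod>i<n. A $$ (i, i)"
  let ?S = "{(\<lambda>A :: 'k mat. A $$ (i, j)) | i j. j < n \<and> i < j}"
  let ?Z = "{A \<in> ?E. \<forall>f\<in>?S. f A = 0}"
  have c: "(\<lambda>A :: 'k mat. A $$ (i, j)) \<in> polyfuns ?F" if "i < n" "j < n" for i j
    using that by (intro polyfuns.coord) (auto simp: mat_coords_def)
  have "openin (zariski ?F ?E) {A \<in> ?E. \<exists>f\<in>{?d}. f A \<noteq> 0}"
    unfolding openin_zariski by (intro exI[of _ "{?d}"]) (auto intro!: polyfuns_prod c)
  moreover have "closedin (zariski ?F ?E) ?Z"
    unfolding closedin_def openin_zariski topspace_zariski
    by (intro conjI exI[of _ ?S]) (auto intro: c)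
  moreover have "borel_subgroup n = {A \<in> ?E. \<exists>f\<in>{?d}. f A \<noteq> 0} \<inter> ?Z"
    unfolding borel_subgroup_altdef by auto
  ultimately show ?thesis unfolding quasi_affine_def by blast
qed

lemma quasi_affine_target_space:
  "quasi_affine (tuple_coords (index_set n)) (index_set n \<rightarrow>\<^sub>E UNIV)
     (target_space n :: (nat \<times> nat \<Rightarrow> 'k::field) set)"
proof -
  let ?I = "index_set n"
  let ?F = "tuple_coords ?I :: ((nat \<times> nat \<Rightarrow> 'k) \<Rightarrow> 'k) set"
  let ?E = "?I \<rightarrow>\<^sub>E UNIV :: (nat \<times> nat \<Rightarrow> 'k) set"
  let ?d = "\<lambda>x :: nat \<times> nat \<Rightarrow> 'k. \<Prod>i\<in>{1..n}. x (i, i)"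
  have c: "(\<lambda>x :: nat \<times> nat \<Rightarrow> 'k. x (i, i)) \<in> polyfuns ?F" if "i \<in> {1..n}" for i
    using that by (intro polyfuns.coord) (auto simp: tuple_coords_def index_set_def)
  have "openin (zariski ?F ?E) {x \<in> ?E. \<exists>f\<in>{?d}. f x \<noteq> 0}"
    unfolding openin_zariski by (intro exI[of _ "{?d}"]) (auto intro!: polyfuns_prod c)
  moreover have "target_space n = {x \<in> ?E. \<exists>f\<in>{?d}. f x \<noteq> 0}"
  proof -
    have "target_space n = {x \<in> ?E. \<forall>i\<in>{1..n}. x (i, i) \<noteq> 0}"
      by (rule Set.set_eqI) (auto simp: target_space_def index_set_def PiE_iff)
    then show ?thesis by simp
  qed
  moreover have "closedin (zariski ?F ?E) ?E"
    by (metis closedin_topspace topspace_zariski)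
  ultimately show ?thesis
    unfolding quasi_affine_def
    by (intro exI[of _ "{x \<in> ?E. \<exists>f\<in>{?d}. f x \<noteq> 0}"] exI[of _ ?E]) auto
qed

end

theory Submission
  imports Defs
begin

text \<open>
  Let \<open>q\<^sub>m\<close> be the characteristic polynomial of \<open>D\<^sub>m\<close> and \<open>h\<^sub>m = x q\<^sub>m - q\<^bsub>m+1\<^esub>\<close>, and number rows and columns
  from 0. Every row of \<open>D = AC\<close> is constant from the diagonal on, so subtracting neighbouring columns
  of \<open>x - D\<^bsub>m+1\<^esub>\<close> gives
  \<open>h\<^sub>m = d\<^bsub>m,m\<^esub> q\<^sub>m + (\<Sum>j<m. d\<^bsub>m,j\<^esub> x\<^bsup>m-1-j\<^esup> h\<^sub>j)\<close>.
  Since \<open>deg h\<^sub>j \<le> j\<close> and \<open>h\<^sub>j(0) = - q\<^bsub>j+1\<^esub>(0) = \<plusminus> det D\<^bsub>j+1\<^esub> \<noteq> 0\<close>, comparing the coefficient of \<open>x\<^sup>m\<close> and then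
  those of \<open>1, x, x\<^sup>2, \<dots>\<close> recovers row \<open>m\<close> of \<open>D\<close> from the polynomials \<open>q\<^sub>j\<close>, that is, from the values of
  \<open>P\<close>, dividing only by the \<open>q\<^bsub>j+1\<^esub>(0)\<close>. Conversely, the rows computed in this way from an
  arbitrary point of the target have the prescribed characteristic polynomials.
\<close>

section \<open>A recursion for the characteristic polynomials\<close>

text \<open>Subtracting column \<open>m\<close> from the last one leaves only two nonzero entries there.\<close>

lemma det_bordered_rec:
  fixes N :: "nat \<Rightarrow> nat \<Rightarrow> 'a::comm_ring_1"
  assumes const: "\<And>r c. r < c \<Longrightarrow> N r (Suc c) = N r c"
    and step: "\<And>r. N r (Suc r) = N r r - x"
  defines "B \<equiv> \<lambda>m v. det (mat (Suc m) (Suc m) (\<lambda>(r, c). if r < m then N r c else v c))"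
  shows "B (Suc m) v = (v (Suc m) - v m) * B m (N m) + x * B m v"
proof -
  let ?M = "mat (Suc (Suc m)) (Suc (Suc m)) (\<lambda>(r, c). if r < Suc m then N r c else v c)"
  let ?A = "addcol (-1) (Suc m) m ?M"
  have "B (Suc m) v = det ?A"
    unfolding B_def by (rule det_addcol[of m "Suc (Suc m)", symmetric]) auto
  also have "\<dots> = (\<Sum>r<Suc (Suc m). ?A $$ (r, Suc m) * cofactor ?A r (Suc m))"
    by (rule laplace_expansion_column) auto
  also have "\<dots> = (\<Sum>r\<in>{m, Suc m}. ?A $$ (r, Suc m) * cofactor ?A r (Suc m))"
    by (rule sum.mono_neutral_right) (auto simp: const less_Suc_eq)
  \<comment> \<open>The entry in row \<open>m\<close> is \<open>- x\<close> by \<open>step\<close>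
    and its cofactor has sign -1, so the signs cancel.\<close>
  also have "\<dots> = x * det (mat_delete ?A m (Suc m))
      + (v (Suc m) - v m) * det (mat_delete ?A (Suc m) (Suc m))"
    by (simp add: step cofactor_def)
  also have "mat_delete ?A m (Suc m) =
      mat (Suc m) (Suc m) (\<lambda>(r, c). if r < m then N r c else v c)"
    by (intro eq_matI) (auto simp: mat_delete_def)
  also have "mat_delete ?A (Suc m) (Suc m) =
      mat (Suc m) (Suc m) (\<lambda>(r, c). if r < m then N r c else N m c)"
    by (intro eq_matI) (auto simp: mat_delete_def less_Suc_eq)
  finally show ?thesis by (simp add: B_def algebra_simps)
qed

text \<open>The shape that \<open>A * C\<close> has for lower triangular \<open>A\<close>. Arrays
  over all natural indices let one \<open>d\<close> supply the blocks of every size.\<close>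

definition row_const :: "(nat \<Rightarrow> nat \<Rightarrow> 'a) \<Rightarrow> bool" where
  "row_const d \<longleftrightarrow> (\<forall>r c. r \<le> c \<longrightarrow> d r c = d r r)"

lemma row_constD: "row_const d \<Longrightarrow> r \<le> c \<Longrightarrow> d r c = d r r"
  unfolding row_const_def by blast

definition block_char_poly :: "(nat \<Rightarrow> nat \<Rightarrow> 'a::comm_ring_1) \<Rightarrow> nat \<Rightarrow> 'a poly" where
  "block_char_poly d m = char_poly (mat m m (\<lambda>(r, c). d r c))"

definition step_defect :: "(nat \<Rightarrow> 'a::comm_ring_1 poly) \<Rightarrow> nat \<Rightarrow> 'a poly" where
  "step_defect q m = pCons 0 (q m) - q (Suc m)"

lemma block_char_poly_0 [simp]: "block_char_poly d 0 = 1"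
  by (simp add: block_char_poly_def char_poly_def char_poly_matrix_def)

text \<open>Unrolls \<open>det_bordered_rec\<close> for the characteristic matrix. The last row
  \<open>v\<close> stays arbitrary because each step keeps it while shrinking the matrix; only the
  terms \<open>B m (N m)\<close> are characteristic polynomials.\<close>

lemma det_bordered_char_poly:
  fixes d :: "nat \<Rightarrow> nat \<Rightarrow> 'a::comm_ring_1"
  assumes d: "row_const d"
  defines "N \<equiv> \<lambda>r c. (if r = c then [:0, 1:] else 0) - [:d r c:]"
  shows "det (mat (Suc m) (Suc m) (\<lambda>(r, c). if r < m then N r c else v c)) =
    v m * block_char_poly d m
      + (\<Sum>j<m. v j * (monom 1 (m - 1 - j) * step_defect (block_char_poly d) j))"
proof -
  define B where "B m v = det (mat (Suc m) (Suc m) (\<lambda>(r, c). if r < m then N r c else v c))" for m v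
  have rec: "B (Suc m) v = (v (Suc m) - v m) * B m (N m) + [:0, 1:] * B m v" for m v
    unfolding B_def
  proof (rule det_bordered_rec)
    fix r c :: nat assume "r < c"
    then show "N r (Suc c) = N r c"
      using row_constD[OF d, of r c] row_constD[OF d, of r "Suc c"] by (simp add: N_def)
  next
    fix r
    show "N r (Suc r) = N r r - [:0, 1:]"
      using row_constD[OF d, of r "Suc r"] by (simp add: N_def)
  qed
  have chi: "B m (N m) = block_char_poly d (Suc m)" for m
    unfolding B_def block_char_poly_def char_poly_def
    by (rule arg_cong[where f = det], rule eq_matI)
      (auto simp: N_def char_poly_matrix_def less_Suc_eq)
  have "B m v = v m * block_char_poly d m
      + (\<Sum>j<m. v j * (monom 1 (m - 1 - j) * step_defect (block_char_poly d) j))"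
  proof (induction m)
    case 0
    then show ?case by (simp add: B_def det_single)
  next
    case (Suc m)
    let ?h = "step_defect (block_char_poly d)"
    have "[:0, 1:] * (v j * (monom 1 (m - 1 - j) * ?h j)) = v j * (monom 1 (m - j) * ?h j)"
      if "j < m" for j
    proof -
      have "m - j = Suc (m - 1 - j)" using that by simp
      then have "monom 1 (m - j) = [:0, 1:] * (monom 1 (m - 1 - j) :: 'a poly)"
        by (simp add: monom_Suc)
      then show ?thesis by (simp only: mult.assoc mult.left_commute)
    qed
    then have "[:0, 1:] * (\<Sum>j<m. v j * (monom 1 (m - 1 - j) * ?h j)) =
        (\<Sum>j<m. v j * (monom 1 (m - j) * ?h j))"
      unfolding sum_distrib_left by (intro sum.cong) auto
    then have S: "(\<Sum>j<Suc m. v j * (monom 1 (Suc m - 1 - j) * ?h j)) =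
        [:0, 1:] * (\<Sum>j<m. v j * (monom 1 (m - 1 - j) * ?h j)) + v m * ?h m"
      by simp
    have h: "?h m = [:0, 1:] * block_char_poly d m - block_char_poly d (Suc m)"
      by (simp add: step_defect_def)
    \<comment> \<open>With \<open>b = v m\<close>, the terms \<open>- b * c\<close> and
      \<open>x * b * e\<close> merge into \<open>b\<close> times the new
      \<open>step_defect\<close>.\<close>
    have "(a - b) * c + x * (b * e + T) = a * c + (x * T + b * (x * e - c))"
      for a b c e x T :: "'a poly"
      by (simp add: algebra_simps)
    then show ?case
      unfolding rec chi Suc.IH S h .
  qed
  then show ?thesis by (simp add: B_def)
qed

text \<open>Takes for \<open>v\<close> row \<open>m\<close> of the characteristic matrix: its
  entries left of the diagonal are free of the indeterminate x, and the x on the diagonal yields the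
  first term of \<open>step_defect\<close>.\<close>

lemma step_defect_block_char_poly:
  fixes d :: "nat \<Rightarrow> nat \<Rightarrow> 'a::comm_ring_1"
  assumes d: "row_const d"
  shows "step_defect (block_char_poly d) m = Polynomial.smult (d m m) (block_char_poly d m)
      + (\<Sum>j<m. Polynomial.smult (d m j) (monom 1 (m - 1 - j) * step_defect (block_char_poly d) j))"
proof -
  let ?N = "\<lambda>r c. (if r = c then [:0, 1:] else 0) - [:d r c:]"
  have "block_char_poly d (Suc m) =
      det (mat (Suc m) (Suc m) (\<lambda>(r, c). if r < m then ?N r c else ?N m c))"
    unfolding block_char_poly_def char_poly_def
    by (rule arg_cong[where f = det], rule eq_matI)
      (auto simp: char_poly_matrix_def less_Suc_eq)
  also have "\<dots> = ?N m m * block_char_poly d m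
      + (\<Sum>j<m. ?N m j * (monom 1 (m - 1 - j) * step_defect (block_char_poly d) j))"
    by (rule det_bordered_char_poly[OF d])
  also have "(\<Sum>j<m. ?N m j * (monom 1 (m - 1 - j) * step_defect (block_char_poly d) j)) =
      - (\<Sum>j<m. Polynomial.smult (d m j) (monom 1 (m - 1 - j) * step_defect (block_char_poly d) j))"
    unfolding sum_negf[symmetric] by (intro sum.cong) auto
  finally have "block_char_poly d (Suc m) = ([:0, 1:] - [:d m m:]) * block_char_poly d m
      - (\<Sum>j<m. Polynomial.smult (d m j) (monom 1 (m - 1 - j) * step_defect (block_char_poly d) j))"
    by (simp only: simp_thms if_True add_uminus_conv_diff)
  moreover have "([:0, 1:] - [:d m m:]) * block_char_poly d m =
      pCons 0 (block_char_poly d m) - Polynomial.smult (d m m) (block_char_poly d m)"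
    by (simp only: left_diff_distrib mult_pCons_left) simp
  ultimately show ?thesis
    unfolding step_defect_def[of _ m] by (simp only: diff_diff_eq diff_diff_eq2 add_diff_cancel_left')
qed

section \<open>Solving for the rows\<close>

text \<open>Forward substitution: the coefficient of x^i in the sum of all c_k x^k g_k is triangular
  in the unknowns c_k, with diagonal entry \<open>coeff (g i) 0\<close>.\<close>

function triangular_coeff :: "(nat \<Rightarrow> 'a::field poly) \<Rightarrow> 'a poly \<Rightarrow> nat \<Rightarrow> 'a" where
  "triangular_coeff g R i =
     (coeff R i - (\<Sum>k<i. triangular_coeff g R k * coeff (g k) (i - k))) / coeff (g i) 0"
  by pat_completeness auto
termination by (relation "measure (\<lambda>(g, R, i). i)") auto

declare triangular_coeff.simps [simp del]

text \<open>The coefficients of x^k for \<open>k < m\<close> give a triangular system with nonzero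
  diagonal. By \<open>deg\<close> and \<open>R\<close> both sides vanish in higher degrees, so these
  \<open>m\<close> equations suffice.\<close>

lemma triangular_coeff_iff:
  assumes nz: "\<And>i. i < m \<Longrightarrow> coeff (g i) 0 \<noteq> 0"
    and deg: "\<And>i. i < m \<Longrightarrow> i + degree (g i) < m"
    and R: "\<And>i. i \<ge> m \<Longrightarrow> coeff R i = 0"
  shows "R = (\<Sum>i<m. Polynomial.smult (c i) (monom 1 i * g i)) \<longleftrightarrow>
    (\<forall>i<m. c i = triangular_coeff g R i)"
proof -
  let ?T = "\<Sum>i<m. Polynomial.smult (c i) (monom 1 i * g i)"
  have coeff: "coeff ?T k = (\<Sum>i<k. c i * coeff (g i) (k - i)) + c k * coeff (g k) 0" if "k < m" for k
  proof -
    have "coeff ?T k = (\<Sum>i<m. c i * (if k < i then 0 else coeff (g i) (k - i)))"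
      by (auto simp: coeff_sum coeff_monom_mult intro!: sum.cong)
    also have "\<dots> = (\<Sum>i<Suc k. c i * (if k < i then 0 else coeff (g i) (k - i)))"
      using that by (intro sum.mono_neutral_right) auto
    finally show ?thesis by simp
  qed
  have high: "coeff ?T k = 0" if "k \<ge> m" for k
  proof -
    have "coeff (g i) (k - i) = 0" if "i < m" for i
      using deg[OF that] \<open>k \<ge> m\<close> by (intro coeff_eq_0) linarith
    then show ?thesis by (auto simp: coeff_sum coeff_monom_mult intro!: sum.neutral)
  qed
  have solve: "coeff R k = coeff ?T k \<longleftrightarrow>
      c k = (coeff R k - (\<Sum>i<k. c i * coeff (g i) (k - i))) / coeff (g k) 0" if "k < m" for k
    unfolding coeff[OF that] using nz[OF that] by (subst eq_divide_eq) (auto simp: algebra_simps)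
  have "R = ?T \<longleftrightarrow> (\<forall>k<m. coeff R k = coeff ?T k)"
    using R high unfolding poly_eq_iff by (metis leI)
  also have "\<dots> \<longleftrightarrow>
      (\<forall>k<m. c k = (coeff R k - (\<Sum>i<k. c i * coeff (g i) (k - i))) / coeff (g k) 0)"
    using solve by blast
  also have "\<dots> \<longleftrightarrow> (\<forall>i<m. c i = triangular_coeff g R i)" (is "?l \<longleftrightarrow> ?r")
  proof
    assume l: ?l
    have "i < m \<longrightarrow> c i = triangular_coeff g R i" for i
    proof (induction i rule: less_induct)
      case (less i)
      show ?case
      proof
        assume i: "i < m"
        have "(\<Sum>k<i. c k * coeff (g k) (i - k)) = (\<Sum>k<i. triangular_coeff g R k * coeff (g k) (i - k))"
          using less i by (intro sum.cong) auto
        then show "c i = triangular_coeff g R i"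
          using l i by (simp add: triangular_coeff.simps[of g R i])
      qed
    qed
    then show ?r by blast
  next
    assume r: ?r
    show ?l
    proof (intro allI impI)
      fix k assume k: "k < m"
      have "(\<Sum>i<k. c i * coeff (g i) (k - i)) = (\<Sum>i<k. triangular_coeff g R i * coeff (g i) (k - i))"
        using r k by (intro sum.cong) auto
      then show "c k = (coeff R k - (\<Sum>i<k. c i * coeff (g i) (k - i))) / coeff (g k) 0"
        using r k by (simp add: triangular_coeff.simps[of g R k])
    qed
  qed
  finally show ?thesis .
qed

text \<open>What the characteristic polynomials of the blocks of size 0 to \<open>n\<close> satisfy
  when all leading principal minors are nonzero, since the constant coefficient is the determinant
  up to sign.\<close>

definition admissible :: "nat \<Rightarrow> (nat \<Rightarrow> 'a::field poly) \<Rightarrow> bool" where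
  "admissible n q \<longleftrightarrow> q 0 = 1 \<and>
     (\<forall>j\<le>n. degree (q j) = j \<and> coeff (q j) j = 1 \<and> coeff (q j) 0 \<noteq> 0)"

text \<open>Row \<open>m\<close> of \<open>D\<close> read off from the recursion. The sum there has
  degree below \<open>m\<close> and \<open>q m\<close> is monic, so the coefficient of x^m is the
  diagonal entry; replacing \<open>j\<close> by \<open>m - 1 - j\<close> orders the rest by powers
  of x. The last branch extends the row as a constant beyond the diagonal.\<close>

definition block_entry :: "(nat \<Rightarrow> 'a::field poly) \<Rightarrow> nat \<Rightarrow> nat \<Rightarrow> 'a" where
  "block_entry q m j =
     (if j < m
      then triangular_coeff (\<lambda>i. step_defect q (m - 1 - i))
        (step_defect q m - Polynomial.smult (coeff (step_defect q m) m) (q m)) (m - 1 - j)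
      else coeff (step_defect q m) m)"

lemma row_const_block_entry: "row_const (block_entry q)"
  by (simp add: row_const_def block_entry_def)

lemma coeff_step_defect_0: "coeff (step_defect q m) 0 = - coeff (q (Suc m)) 0"
  by (simp add: step_defect_def)

text \<open>Both terms of \<open>step_defect\<close> are monic of degree \<open>m + 1\<close>, so
  their leading terms cancel.\<close>

lemma coeff_step_defect_eq_0:
  assumes q: "admissible n q" and m: "m < n" and i: "i > m"
  shows "coeff (step_defect q m) i = 0"
proof -
  have "degree (q m) = m" "coeff (q m) m = 1"
    and "degree (q (Suc m)) = Suc m" "coeff (q (Suc m)) (Suc m) = 1"
    using q m by (auto simp: admissible_def)
  then show ?thesis
    using i by (cases "i = Suc m") (auto simp: step_defect_def coeff_pCons coeff_eq_0 split: nat.split)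
qed

text \<open>The coefficient at \<open>m\<close> fixes \<open>w m\<close>; what remains is triangular
  with the nonzero constant terms of earlier \<open>step_defect\<close> polynomials on its diagonal.
  The equivalence gives existence and uniqueness of the row at once.\<close>

lemma block_entry_iff:
  assumes q: "admissible n q" and m: "m < n"
  shows "step_defect q m = Polynomial.smult (w m) (q m)
      + (\<Sum>j<m. Polynomial.smult (w j) (monom 1 (m - 1 - j) * step_defect q j)) \<longleftrightarrow>
    (\<forall>j\<le>m. w j = block_entry q m j)"
proof -
  let ?h = "step_defect q" and ?g = "\<lambda>i. step_defect q (m - 1 - i)"
  let ?t = "coeff (?h m) m"
  let ?R = "?h m - Polynomial.smult ?t (q m)"
  let ?S = "\<Sum>j<m. Polynomial.smult (w j) (monom 1 (m - 1 - j) * ?h j)"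
  have qm: "degree (q m) = m" "coeff (q m) m = 1" using q m by (auto simp: admissible_def)
  have hdeg: "degree (?h j) \<le> j" if "j < n" for j
    using coeff_step_defect_eq_0[OF q that] by (intro degree_le) auto
  have S: "?S = (\<Sum>i<m. Polynomial.smult (w (m - 1 - i)) (monom 1 i * ?g i))"
    by (rule sum.reindex_bij_witness[of _ "\<lambda>i. m - 1 - i" "\<lambda>i. m - 1 - i"]) auto
  have S0: "coeff ?S m = 0"
  proof -
    \<comment> \<open>Here \<open>m - (m - 1 - j)\<close> is \<open>j + 1\<close>, above the degree
      of \<open>?h j\<close>.\<close>
    have "coeff (?h j) (m - (m - 1 - j)) = 0" if "j < m" for j
      using that m by (intro coeff_step_defect_eq_0[OF q]) auto
    then show ?thesis by (simp add: coeff_sum coeff_monom_mult)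
  qed
  have tri: "?R = ?S \<longleftrightarrow> (\<forall>i<m. w (m - 1 - i) = triangular_coeff ?g ?R i)"
    unfolding S
  proof (rule triangular_coeff_iff)
    fix i assume i: "i < m"
    then show "coeff (?g i) 0 \<noteq> 0" using q m by (simp add: coeff_step_defect_0 admissible_def)
    show "i + degree (?g i) < m" using hdeg[of "m - 1 - i"] i m by linarith
  next
    fix i assume "i \<ge> m"
    then show "coeff ?R i = 0"
      using qm coeff_step_defect_eq_0[OF q m, of i]
      by (cases "i = m") (auto simp: coeff_eq_0)
  qed
  have "?h m = Polynomial.smult (w m) (q m) + ?S \<longleftrightarrow> w m = ?t \<and> ?R = ?S" (is "?l \<longleftrightarrow> ?r")
  proof
    assume l: ?l
    then have "?t = coeff (Polynomial.smult (w m) (q m) + ?S) m" by (rule arg_cong)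
    then have "w m = ?t" using S0 qm by simp
    moreover have "?h m - Polynomial.smult (w m) (q m) = ?S" by (subst l) simp
    ultimately show ?r by simp
  next
    assume ?r
    then show ?l by (metis add_diff_cancel_left' add_diff_eq)
  qed
  also have "\<dots> \<longleftrightarrow> (\<forall>j\<le>m. w j = block_entry q m j)"
  proof -
    have "(\<forall>i<m. w (m - 1 - i) = triangular_coeff ?g ?R i) \<longleftrightarrow>
        (\<forall>j<m. w j = triangular_coeff ?g ?R (m - 1 - j))" (is "?l \<longleftrightarrow> ?r")
    proof
      assume l: ?l
      show ?r
      proof (intro allI impI)
        fix j assume "j < m"
        then show "w j = triangular_coeff ?g ?R (m - 1 - j)"
          using l[rule_format, of "m - 1 - j"] by simp
      qed
    next
      assume r: ?r
      show ?l
      proof (intro allI impI)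
        fix i assume "i < m"
        then show "w (m - 1 - i) = triangular_coeff ?g ?R i"
          using r[rule_format, of "m - 1 - i"] by simp
      qed
    qed
    then show ?thesis unfolding tri by (auto simp: block_entry_def le_less)
  qed
  finally show ?thesis .
qed

text \<open>Left to right, the polynomials determine the rows, which gives injectivity; right to
  left, every admissible sequence is realised, which gives surjectivity.\<close>

lemma block_char_poly_eq_iff:
  assumes q: "admissible n q" and d: "row_const d"
  shows "(\<forall>m\<le>n. block_char_poly d m = q m) \<longleftrightarrow> (\<forall>m<n. \<forall>j\<le>m. d m j = block_entry q m j)"
    (is "?l \<longleftrightarrow> ?r")
proof
  assume l: ?l
  then have h: "step_defect (block_char_poly d) j = step_defect q j" if "j < n" for j
    using that by (simp add: step_defect_def)
  show ?r
  proof (intro allI impI)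
    fix m j assume m: "m < n" and j: "j \<le> m"
    have "step_defect q m = Polynomial.smult (d m m) (q m)
      + (\<Sum>j<m. Polynomial.smult (d m j) (monom 1 (m - 1 - j) * step_defect q j))"
      using step_defect_block_char_poly[OF d, of m] l m by (simp add: h)
    then show "d m j = block_entry q m j" using block_entry_iff[OF q m] j by blast
  qed
next
  assume r: ?r
  have "m \<le> n \<longrightarrow> block_char_poly d m = q m" for m
  proof (induction m rule: less_induct)
    case (less m)
    show ?case
    proof (cases m)
      case 0
      then show ?thesis using q by (simp add: admissible_def)
    next
      case (Suc k)
      show ?thesis
      proof
        assume mn: "m \<le> n"
        then have k: "k < n" using Suc by simp
        \<comment> \<open>Only blocks of size at most \<open>k\<close> enter here, so the induction
          hypothesis applies; the recursion then passes to size \<open>k + 1\<close>.\<close>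
        have h: "step_defect (block_char_poly d) j = step_defect q j" if "j < k" for j
          using that less.IH Suc mn by (simp add: step_defect_def)
        have "step_defect (block_char_poly d) k = step_defect q k"
          using step_defect_block_char_poly[OF d, of k] block_entry_iff[OF q k, of "d k"] r k
            less.IH[of k] Suc by (simp add: h)
        then show "block_char_poly d m = q m"
          using less.IH[of k] k Suc by (simp add: step_defect_def)
      qed
    qed
  qed
  then show ?l by blast
qed

text \<open>In the constant term of the recursion only the summand \<open>j = m - 1\<close>
  survives, as the others have a factor x. For \<open>partial_sums A\<close> the bracket is
  \<open>A $$ (m, m)\<close>, which ties the diagonal of \<open>A\<close> to the constant
  terms.\<close>

lemma coeff_block_char_poly_Suc_0:
  fixes d :: "nat \<Rightarrow> nat \<Rightarrow> 'a::comm_ring_1"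
  assumes d: "row_const d"
  shows "coeff (block_char_poly d (Suc m)) 0 =
    - (d m m - (if m = 0 then 0 else d m (m - 1))) * coeff (block_char_poly d m) 0"
proof -
  let ?h = "step_defect (block_char_poly d)"
  have "(\<Sum>j<m. d m j * coeff (monom 1 (m - 1 - j) * ?h j) 0) =
      (if m = 0 then 0 else d m (m - 1) * coeff (?h (m - 1)) 0)"
  proof (cases m)
    case (Suc k)
    have "(\<Sum>j<m. d m j * coeff (monom 1 (m - 1 - j) * ?h j) 0) =
        (\<Sum>j\<in>{k}. d m j * coeff (monom 1 (m - 1 - j) * ?h j) 0)"
      by (rule sum.mono_neutral_right) (auto simp: Suc coeff_monom_mult)
    then show ?thesis by (simp add: Suc coeff_monom_mult)
  qed simp
  then have "coeff (?h m) 0 = d m m * coeff (block_char_poly d m) 0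
      + (if m = 0 then 0 else d m (m - 1) * coeff (?h (m - 1)) 0)"
    by (subst step_defect_block_char_poly[OF d]) (simp add: coeff_sum)
  then have "- coeff (block_char_poly d (Suc m)) 0 =
      (d m m - (if m = 0 then 0 else d m (m - 1))) * coeff (block_char_poly d m) 0"
    by (cases m) (simp_all add: coeff_step_defect_0 algebra_simps)
  then show ?thesis by (metis minus_minus mult_minus_left)
qed


section \<open>The inverse map\<close>

text \<open>
  The entries of \<open>AC\<close> for lower triangular \<open>A\<close>. Outside the range of \<open>A\<close> the values are junk, but
  by the use of \<open>min\<close> the rows are constant from the diagonal on even there.
\<close>

definition partial_sums :: "'a::field mat \<Rightarrow> nat \<Rightarrow> nat \<Rightarrow> 'a" where
  "partial_sums A r c = (\<Sum>k\<le>min r c. A $$ (r, k))"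

lemma row_const_partial_sums: "row_const (partial_sums A)"
  by (simp add: row_const_def partial_sums_def)

lemma partial_sums_diff:
  "partial_sums A m m - (if m = 0 then 0 else partial_sums A m (m - 1)) = A $$ (m, m)"
  by (cases m) (simp_all add: partial_sums_def)

lemma upper_left_block_times_C:
  assumes A: "A \<in> borel_subgroup n" and i: "i \<le> n"
  shows "upper_left_block (A * C_mat n) i = mat i i (\<lambda>(r, c). partial_sums A r c)"
proof -
  have A': "A \<in> carrier_mat n n" and low: "\<And>i j. i < j \<Longrightarrow> j < n \<Longrightarrow> A $$ (i, j) = 0"
    using A unfolding borel_subgroup_altdef by auto
  have entry: "(A * C_mat n) $$ (r, c) = partial_sums A r c" if "r < i" "c < i" for r c
  proof -
    have "(A * C_mat n) $$ (r, c) = (\<Sum>k\<in>{0..<n}. A $$ (r, k) * (if k \<le> c then 1 else 0))"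
      using A' that i by (simp add: C_mat_def scalar_prod_def)
    \<comment> \<open>\<open>C\<close> restricts the sum to \<open>k \<le> c\<close>, triangularity
      of \<open>A\<close> to \<open>k \<le> r\<close>.\<close>
    also have "\<dots> = (\<Sum>k\<le>min r c. A $$ (r, k) * (if k \<le> c then 1 else 0))"
      using that i low by (intro sum.mono_neutral_right) auto
    also have "\<dots> = partial_sums A r c"
      unfolding partial_sums_def by (intro sum.cong) auto
    finally show ?thesis .
  qed
  have "A * C_mat n \<in> carrier_mat n n" using A' by (simp add: C_mat_def)
  then show ?thesis
    using entry i by (subst upper_left_block_eq) (auto intro!: eq_matI)
qed

text \<open>The monic polynomial of degree \<open>m\<close> that has the values \<open>y (m, h)\<close> as its \<open>P\<^sub>h\<close>.\<close>

definition tuple_poly :: "(nat \<times> nat \<Rightarrow> 'a::comm_ring_1) \<Rightarrow> nat \<Rightarrow> 'a poly" where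
  "tuple_poly y m = (\<Sum>k\<le>m. monom (if k = m then 1 else (- 1) ^ (m - k) * y (m, m - k)) k)"

lemma coeff_tuple_poly:
  "coeff (tuple_poly y m) k =
    (if k < m then (- 1) ^ (m - k) * y (m, m - k) else if k = m then 1 else 0)"
  by (auto simp: tuple_poly_def coeff_sum)

lemma degree_tuple_poly: "degree (tuple_poly y m) = m"
  by (rule antisym[OF degree_le le_degree]) (auto simp: coeff_tuple_poly)

lemma target_spaceD:
  assumes "y \<in> target_space n" "1 \<le> i" "i \<le> n"
  shows "y (i, i) \<noteq> 0"
proof -
  have "(i, i) \<in> index_set n" using assms by (simp add: index_set_def)
  then show ?thesis using assms(1) PiE_mem unfolding target_space_def by fastforce
qed

lemma admissible_tuple_poly:
  assumes "y \<in> target_space n"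
  shows "admissible n (tuple_poly y)"
  unfolding admissible_def
  using target_spaceD[OF assms]
  by (auto simp: degree_tuple_poly coeff_tuple_poly poly_eq_iff coeff_pCons one_pCons split: nat.split)

text \<open>The signs in \<open>tuple_poly\<close> are those of \<open>P_coeff_char_poly\<close>
  with \<open>h = m - k\<close>. This turns questions about \<open>Pi_map\<close> into questions
  about characteristic polynomials.\<close>

lemma tuple_poly_Pi_map:
  fixes A :: "'k::field mat"
  assumes A: "A \<in> borel_subgroup n" and m: "m \<le> n"
  shows "tuple_poly (Pi_map n A) m = block_char_poly (partial_sums A) m"
proof (rule poly_eqI)
  fix k
  let ?X = "mat m m (\<lambda>(r, c). partial_sums A r c)"
  have X: "?X \<in> carrier_mat m m" by simp
  note monic = degree_monic_char_poly[OF X]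
  show "coeff (tuple_poly (Pi_map n A) m) k = coeff (block_char_poly (partial_sums A) m) k"
  proof (cases "k < m")
    case True
    then have "(m, m - k) \<in> index_set n" using m by (simp add: index_set_def)
    then have "Pi_map n A (m, m - k) = P_coeff (m - k) ?X"
      using upper_left_block_times_C[OF A m] by (simp add: Pi_map_def)
    then show ?thesis
      using P_coeff_char_poly[OF X, of "m - k"] True
      by (simp add: coeff_tuple_poly block_char_poly_def)
  next
    case False
    then show ?thesis
      using monic by (auto simp: coeff_tuple_poly block_char_poly_def coeff_eq_0)
  qed
qed

lemma tuple_poly_inject:
  fixes y z :: "nat \<times> nat \<Rightarrow> 'a::comm_ring_1"
  assumes "y \<in> extensional (index_set n)" "z \<in> extensional (index_set n)"
    and eq: "\<And>m. m \<le> n \<Longrightarrow> tuple_poly y m = tuple_poly z m"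
  shows "y = z"
proof (rule extensionalityI[OF assms(1,2)])
  fix p assume "p \<in> index_set n"
  then obtain m h where p: "p = (m, h)" "1 \<le> h" "h \<le> m" "m \<le> n" by (auto simp: index_set_def)
  have "(- 1) ^ h * y p = (- 1) ^ h * z p"
    using arg_cong[OF eq[OF p(4)], of "\<lambda>q. coeff q (m - h)"] p by (simp add: coeff_tuple_poly)
  \<comment> \<open>The sign is its own inverse, which cancels it over any commutative ring.\<close>
  then have "(- 1) ^ h * ((- 1) ^ h * y p) = (- 1) ^ h * ((- 1) ^ h * z p)" by simp
  then show "y p = z p" by (simp flip: mult.assoc power_add)
qed

text \<open>Differences of neighbouring columns invert right multiplication by \<open>C\<close>, so
  the product of this matrix with \<open>C\<close> has the rows \<open>block_entry\<close>.\<close>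

definition borel_of_tuple :: "nat \<Rightarrow> (nat \<times> nat \<Rightarrow> 'a::field) \<Rightarrow> 'a mat" where
  "borel_of_tuple n y = mat n n (\<lambda>(r, c).
     if r < c then 0
     else block_entry (tuple_poly y) r c - (if c = 0 then 0 else block_entry (tuple_poly y) r (c - 1)))"

lemma partial_sums_borel_of_tuple:
  assumes "r < n" "c \<le> r"
  shows "partial_sums (borel_of_tuple n y) r c = block_entry (tuple_poly y) r c"
  using assms(2)
proof (induction c)
  case 0
  then show ?case using assms by (simp add: partial_sums_def borel_of_tuple_def)
next
  case (Suc c)
  then have "partial_sums (borel_of_tuple n y) r (Suc c) =
      partial_sums (borel_of_tuple n y) r c + borel_of_tuple n y $$ (r, Suc c)"
    by (simp add: partial_sums_def min_absorb2)
  then show ?case using Suc assms by (simp add: borel_of_tuple_def)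
qed

section \<open>The two maps are mutually inverse\<close>

lemma block_char_poly_borel_of_tuple:
  assumes y: "y \<in> target_space n" and m: "m \<le> n"
  shows "block_char_poly (partial_sums (borel_of_tuple n y)) m = tuple_poly y m"
  using block_char_poly_eq_iff[OF admissible_tuple_poly[OF y] row_const_partial_sums,
      of "borel_of_tuple n y", THEN iffD2] partial_sums_borel_of_tuple m by blast

text \<open>Up to sign, a diagonal entry is the ratio of consecutive constant terms, which
  admissibility keeps nonzero.\<close>

lemma borel_of_tuple_in_borel:
  assumes y: "y \<in> target_space n"
  shows "borel_of_tuple n y \<in> borel_subgroup n"
proof -
  have "borel_of_tuple n y $$ (m, m) \<noteq> 0" if m: "m < n" for m
  proof
    assume "borel_of_tuple n y $$ (m, m) = 0"
    then have "coeff (tuple_poly y (Suc m)) 0 = 0"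
      using coeff_block_char_poly_Suc_0[OF row_const_partial_sums, of "borel_of_tuple n y" m] m
      by (simp only: partial_sums_diff block_char_poly_borel_of_tuple[OF y] Suc_leI) simp
    then show False using admissible_tuple_poly[OF y] m by (simp add: admissible_def)
  qed
  then show ?thesis
    unfolding borel_subgroup_altdef by (auto simp: borel_of_tuple_def)
qed

lemma Pi_map_in_target_space:
  fixes A :: "'k::field mat"
  assumes A: "A \<in> borel_subgroup n"
  shows "Pi_map n A \<in> target_space n"
proof -
  let ?q = "block_char_poly (partial_sums A)"
  \<comment> \<open>Starting from the empty block with polynomial 1, each constant term arises from
    the previous one by the nonzero factor \<open>- A $$ (m, m)\<close>.\<close>
  have nz: "m \<le> n \<longrightarrow> coeff (?q m) 0 \<noteq> 0" for m
  proof (induction m)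
    case (Suc m)
    have "Suc m \<le> n \<longrightarrow> A $$ (m, m) \<noteq> 0"
      using A unfolding borel_subgroup_altdef by auto
    then show ?case
      using Suc by (simp add: coeff_block_char_poly_Suc_0[OF row_const_partial_sums] partial_sums_diff
        del: One_nat_def)
  qed simp
  have "Pi_map n A (i, i) \<noteq> 0" if "1 \<le> i" "i \<le> n" for i
  proof
    assume "Pi_map n A (i, i) = 0"
    then have "coeff (tuple_poly (Pi_map n A) i) 0 = 0" using that by (simp add: coeff_tuple_poly)
    then show False using nz[of i] that tuple_poly_Pi_map[OF A] by simp
  qed
  then show ?thesis
    unfolding target_space_def PiE_iff by (auto simp: index_set_def Pi_map_def)
qed

lemma Pi_map_borel_of_tuple:
  fixes y :: "nat \<times> nat \<Rightarrow> 'k::field"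
  assumes y: "y \<in> target_space n"
  shows "Pi_map n (borel_of_tuple n y) = y"
proof (rule tuple_poly_inject)
  show "Pi_map n (borel_of_tuple n y) \<in> extensional (index_set n)" by (simp add: Pi_map_def)
  show "y \<in> extensional (index_set n)" using y unfolding target_space_def PiE_iff by blast
  show "tuple_poly (Pi_map n (borel_of_tuple n y)) m = tuple_poly y m" if "m \<le> n" for m
    using that tuple_poly_Pi_map[OF borel_of_tuple_in_borel[OF y]]
      block_char_poly_borel_of_tuple[OF y] by simp
qed

lemma borel_of_tuple_Pi_map:
  fixes A :: "'k::field mat"
  assumes A: "A \<in> borel_subgroup n"
  shows "borel_of_tuple n (Pi_map n A) = A"
proof -
  have A': "A \<in> carrier_mat n n" and low: "\<And>i j. i < j \<Longrightarrow> j < n \<Longrightarrow> A $$ (i, j) = 0"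
    using A unfolding borel_subgroup_altdef by auto
  \<comment> \<open>Uniqueness of the rows: the polynomials of \<open>Pi_map n A\<close> are those
    of \<open>partial_sums A\<close> itself.\<close>
  have e: "block_entry (tuple_poly (Pi_map n A)) r c = partial_sums A r c" if "r < n" "c \<le> r" for r c
    using block_char_poly_eq_iff[OF admissible_tuple_poly[OF Pi_map_in_target_space[OF A]]
      row_const_partial_sums, of A, THEN iffD1] tuple_poly_Pi_map[OF A] that by metis
  show ?thesis
  proof (rule eq_matI)
    fix r c assume "r < dim_row A" "c < dim_col A"
    then have rc: "r < n" "c < n" using A' by auto
    show "borel_of_tuple n (Pi_map n A) $$ (r, c) = A $$ (r, c)"
    proof (cases "r < c")
      case True
      then show ?thesis using rc low by (simp add: borel_of_tuple_def)
    next
      case False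
      then show ?thesis
        using rc by (cases c) (simp_all add: borel_of_tuple_def e partial_sums_def min_absorb2)
    qed
  qed (use A' in \<open>auto simp: borel_of_tuple_def\<close>)
qed

section \<open>Regularity\<close>

text \<open>
  Global fractions suffice here, since all denominators that occur are nonzero on the whole variety.
\<close>

definition fraction_on :: "('p \<Rightarrow> 'k::field) set \<Rightarrow> 'p set \<Rightarrow> ('p \<Rightarrow> 'k) \<Rightarrow> bool" where
  "fraction_on F X f \<longleftrightarrow>
     (\<exists>g\<in>polyfuns F. \<exists>h\<in>polyfuns F. \<forall>x\<in>X. h x \<noteq> 0 \<and> f x = g x / h x)"

section \<open>Closure properties of fractions\<close>

lemma fraction_onI:
  assumes "g \<in> polyfuns F" "h \<in> polyfuns F" "\<And>x. x \<in> X \<Longrightarrow> h x \<noteq> 0"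
    "\<And>x. x \<in> X \<Longrightarrow> f x = g x / h x"
  shows "fraction_on F X f"
  using assms unfolding fraction_on_def by blast

lemma fraction_on_cong:
  assumes "fraction_on F X f" "\<And>x. x \<in> X \<Longrightarrow> f x = g x"
  shows "fraction_on F X g"
  using assms unfolding fraction_on_def by auto

lemma fraction_on_polyfun: "f \<in> polyfuns F \<Longrightarrow> fraction_on F X f"
  unfolding fraction_on_def by (intro bexI[of _ f] bexI[of _ "\<lambda>_. 1"]) (auto intro: polyfuns.const)

lemma fraction_on_const: "fraction_on F X (\<lambda>_. c)"
  by (intro fraction_on_polyfun polyfuns.const)

lemma fraction_on_add:
  assumes "fraction_on F X f" "fraction_on F X g"
  shows "fraction_on F X (\<lambda>x. f x + g x)"
proof -
  obtain a b c d where p: "a \<in> polyfuns F" "b \<in> polyfuns F" "c \<in> polyfuns F" "d \<in> polyfuns F"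
    and e: "\<forall>x\<in>X. b x \<noteq> 0 \<and> f x = a x / b x" "\<forall>x\<in>X. d x \<noteq> 0 \<and> g x = c x / d x"
    using assms unfolding fraction_on_def by blast
  have "(\<lambda>x. a x * d x + c x * b x) \<in> polyfuns F" "(\<lambda>x. b x * d x) \<in> polyfuns F"
    using p by (auto intro!: polyfuns.add polyfuns.mult)
  then show ?thesis
    by (rule fraction_onI) (use e in \<open>auto simp: add_frac_eq\<close>)
qed

lemma fraction_on_mult:
  assumes "fraction_on F X f" "fraction_on F X g"
  shows "fraction_on F X (\<lambda>x. f x * g x)"
proof -
  obtain a b c d where p: "a \<in> polyfuns F" "b \<in> polyfuns F" "c \<in> polyfuns F" "d \<in> polyfuns F"
    and e: "\<forall>x\<in>X. b x \<noteq> 0 \<and> f x = a x / b x" "\<forall>x\<in>X. d x \<noteq> 0 \<and> g x = c x / d x"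
    using assms unfolding fraction_on_def by blast
  have "(\<lambda>x. a x * c x) \<in> polyfuns F" "(\<lambda>x. b x * d x) \<in> polyfuns F"
    using p by (auto intro!: polyfuns.mult)
  then show ?thesis
    by (rule fraction_onI) (use e in auto)
qed

lemma fraction_on_divide:
  assumes "fraction_on F X f" "fraction_on F X g" and nz: "\<And>x. x \<in> X \<Longrightarrow> g x \<noteq> 0"
  shows "fraction_on F X (\<lambda>x. f x / g x)"
proof -
  obtain a b c d where p: "a \<in> polyfuns F" "b \<in> polyfuns F" "c \<in> polyfuns F" "d \<in> polyfuns F"
    and e: "\<forall>x\<in>X. b x \<noteq> 0 \<and> f x = a x / b x" "\<forall>x\<in>X. d x \<noteq> 0 \<and> g x = c x / d x"
    using assms(1,2) unfolding fraction_on_def by blast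
  have "(\<lambda>x. a x * d x) \<in> polyfuns F" "(\<lambda>x. b x * c x) \<in> polyfuns F"
    using p by (auto intro!: polyfuns.mult)
  then show ?thesis
    by (rule fraction_onI) (use e nz in auto)
qed

lemma fraction_on_diff:
  assumes f: "fraction_on F X f" and g: "fraction_on F X g"
  shows "fraction_on F X (\<lambda>x. f x - g x)"
  using fraction_on_add[OF f fraction_on_mult[OF fraction_on_const[of F X "- 1"] g]] by simp

lemma fraction_on_sum:
  assumes "\<And>i. i \<in> I \<Longrightarrow> fraction_on F X (f i)"
  shows "fraction_on F X (\<lambda>x. \<Sum>i\<in>I. f i x)"
  using assms
  by (induction I rule: infinite_finite_induct) (auto intro: fraction_on_const fraction_on_add)

lemma fraction_on_prod:
  assumes "\<And>i. i \<in> I \<Longrightarrow> fraction_on F X (f i)"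
  shows "fraction_on F X (\<lambda>x. \<Prod>i\<in>I. f i x)"
  using assms
  by (induction I rule: infinite_finite_induct) (auto intro: fraction_on_const fraction_on_mult)

lemmas fraction_on_intros =
  fraction_on_const fraction_on_add fraction_on_mult fraction_on_diff fraction_on_sum fraction_on_prod

text \<open>A polynomial on the target pulls back to a fraction with nowhere vanishing denominator.
  Its nonvanishing set is that of the numerator, which gives continuity; quotients of such fractions
  give the pullback of regular functions.\<close>

lemma variety_morphismI:
  assumes maps: "\<And>x. x \<in> X \<Longrightarrow> \<phi> x \<in> Y"
    and coords: "\<And>g. g \<in> G \<Longrightarrow> fraction_on F X (\<lambda>x. g (\<phi> x))"
  shows "variety_morphism F X G Y \<phi>"
proof -
  have poly: "fraction_on F X (\<lambda>x. g (\<phi> x))" if "g \<in> polyfuns G" for g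
    using that by induction (auto intro: fraction_on_intros coords)
  have pre: "openin (zariski F X) {x \<in> X. \<phi> x \<in> V}" if V: "openin (zariski G Y) V" for V
  proof -
    obtain S where S: "S \<subseteq> polyfuns G" "V = {y \<in> Y. \<exists>f\<in>S. f y \<noteq> 0}"
      using V unfolding openin_zariski by blast
    have "\<forall>f\<in>S. \<exists>a. a \<in> polyfuns F \<and> (\<forall>x\<in>X. a x \<noteq> 0 \<longleftrightarrow> f (\<phi> x) \<noteq> 0)"
    proof
      fix f assume "f \<in> S"
      then have "fraction_on F X (\<lambda>x. f (\<phi> x))" using S poly by blast
      then obtain a b where "a \<in> polyfuns F" "\<forall>x\<in>X. b x \<noteq> 0 \<and> f (\<phi> x) = a x / b x"
        unfolding fraction_on_def by blast
      then show "\<exists>a. a \<in> polyfuns F \<and> (\<forall>x\<in>X. a x \<noteq> 0 \<longleftrightarrow> f (\<phi> x) \<noteq> 0)" by auto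
    qed
    then obtain a where a: "\<forall>f\<in>S. a f \<in> polyfuns F \<and> (\<forall>x\<in>X. a f x \<noteq> 0 \<longleftrightarrow> f (\<phi> x) \<noteq> 0)"
      by (rule bchoice[elim_format]) blast
    show ?thesis
      unfolding openin_zariski S(2) by (rule exI[of _ "a ` S"]) (use a maps in auto)
  qed
  have "continuous_map (zariski F X) (zariski G Y) \<phi>"
    unfolding continuous_map_def topspace_zariski using maps pre by blast
  moreover have "regular_on F X {x \<in> X. \<phi> x \<in> V} (f \<circ> \<phi>)"
    if f: "regular_on G Y V f" for V f
    unfolding regular_on_def
  proof
    fix p assume p: "p \<in> {x \<in> X. \<phi> x \<in> V}"
    then have "\<phi> p \<in> V" by simp
    from f[unfolded regular_on_def, rule_format, OF this]
    obtain W g h where W: "openin (zariski G Y) W" "\<phi> p \<in> W" "W \<subseteq> V"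
      and gh: "g \<in> polyfuns G" "h \<in> polyfuns G" "\<forall>y\<in>W. h y \<noteq> 0 \<and> f y = g y / h y"
      by (elim exE conjE)
    obtain a b where ab: "a \<in> polyfuns F" "b \<in> polyfuns F"
        "\<forall>x\<in>X. b x \<noteq> 0 \<and> g (\<phi> x) = a x / b x"
      using poly[OF gh(1)] unfolding fraction_on_def by blast
    obtain c d where cd: "c \<in> polyfuns F" "d \<in> polyfuns F"
        "\<forall>x\<in>X. d x \<noteq> 0 \<and> h (\<phi> x) = c x / d x"
      using poly[OF gh(2)] unfolding fraction_on_def by blast
    \<comment> \<open>This is (a/b)/(c/d), and \<open>c x\<close> is nonzero because
      \<open>h\<close> does not vanish on \<open>W\<close>.\<close>
    have "b x * c x \<noteq> 0 \<and> (f \<circ> \<phi>) x = (a x * d x) / (b x * c x)" if "x \<in> X" "\<phi> x \<in> W" for x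
      using that ab(3) cd(3) gh(3) by fastforce
    then show "\<exists>V' g h. openin (zariski F X) V' \<and> p \<in> V' \<and> V' \<subseteq> {x \<in> X. \<phi> x \<in> V} \<and>
        g \<in> polyfuns F \<and> h \<in> polyfuns F \<and> (\<forall>x\<in>V'. h x \<noteq> 0 \<and> (f \<circ> \<phi>) x = g x / h x)"
      using pre[OF W(1)] W p ab cd
      by (intro exI[of _ "{x \<in> X. \<phi> x \<in> W}"] exI[of _ "\<lambda>x. a x * d x"] exI[of _ "\<lambda>x. b x * c x"])
        (auto intro: polyfuns.mult)
  qed
  ultimately show ?thesis unfolding variety_morphism_def by blast
qed

section \<open>Regularity of \<open>Pi_map\<close> and of its inverse\<close>

lemma fraction_on_mat_entry:
  "i < n \<Longrightarrow> j < n \<Longrightarrow> fraction_on (mat_coords n) X (\<lambda>A. A $$ (i, j))"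
  by (intro fraction_on_polyfun polyfuns.coord) (auto simp: mat_coords_def)

lemma variety_morphism_Pi_map:
  "variety_morphism (mat_coords n) (borel_subgroup n)
     (tuple_coords (index_set n)) (target_space n) (Pi_map n :: 'k::field mat \<Rightarrow> _)"
proof (rule variety_morphismI[OF Pi_map_in_target_space])
  fix g :: "(nat \<times> nat \<Rightarrow> 'k) \<Rightarrow> 'k" assume "g \<in> tuple_coords (index_set n)"
  then obtain i h where g: "g = (\<lambda>y. y (i, h))" and ih: "(i, h) \<in> index_set n"
    by (auto simp: tuple_coords_def)
  then have i: "i \<le> n" by (simp add: index_set_def)
  let ?\<S> = "{S. S \<subseteq> {..<i} \<and> card S = h}"
  \<comment> \<open>The Leibniz expansion of the principal minors: polynomial in the entries of
    \<open>A\<close>, and equal to the coordinate of \<open>Pi_map\<close> on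
    \<open>borel_subgroup n\<close>.\<close>
  let ?f = "\<lambda>A. \<Sum>S\<in>?\<S>. \<Sum>p | p permutes S. signof p * (\<Prod>r\<in>S. partial_sums A r (p r))"
  have "fraction_on (mat_coords n) (borel_subgroup n) (\<lambda>A. partial_sums A r c)" if "r < i" for r c
    unfolding partial_sums_def using that i
    by (intro fraction_on_intros fraction_on_mat_entry) auto
  then have "fraction_on (mat_coords n) (borel_subgroup n) ?f"
    by (intro fraction_on_intros) auto
  then show "fraction_on (mat_coords n) (borel_subgroup n) (\<lambda>A. g (Pi_map n A))"
  proof (rule fraction_on_cong)
    fix A :: "'k mat" assume A: "A \<in> borel_subgroup n"
    let ?X = "mat i i (\<lambda>(r, c). partial_sums A r c)"
    have "g (Pi_map n A) = (\<Sum>S\<in>?\<S>. det (submatrix ?X S S))"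
      using ih upper_left_block_times_C[OF A i] by (simp add: g Pi_map_def P_coeff_def)
    also have "\<dots> = ?f A"
    proof (intro sum.cong refl)
      fix S assume S: "S \<in> ?\<S>"
      then have "det (submatrix ?X S S) = (\<Sum>p | p permutes S. signof p * (\<Prod>r\<in>S. ?X $$ (r, p r)))"
        by (intro det_submatrix_eq[of _ i]) auto
      also have "\<dots> = (\<Sum>p | p permutes S. signof p * (\<Prod>r\<in>S. partial_sums A r (p r)))"
      proof (intro sum.cong refl arg_cong2[where f = "(*)"] prod.cong)
        fix p r assume "p \<in> {p. p permutes S}" "r \<in> S"
        then have "r < i" "p r < i" using S permutes_in_image[of p S r] by auto
        then show "?X $$ (r, p r) = partial_sums A r (p r)" by simp
      qed
      finally show "det (submatrix ?X S S) =
        (\<Sum>p | p permutes S. signof p * (\<Prod>r\<in>S. partial_sums A r (p r)))" .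
    qed
    finally show "?f A = g (Pi_map n A)" by simp
  qed
qed

lemma fraction_on_coeff_tuple_poly:
  assumes "m \<le> n"
  shows "fraction_on (tuple_coords (index_set n)) X (\<lambda>y. coeff (tuple_poly y m) k)"
proof -
  have "fraction_on (tuple_coords (index_set n)) X (\<lambda>y. y (m, m - k))" if "k < m"
  proof (intro fraction_on_polyfun polyfuns.coord)
    have "(m, m - k) \<in> index_set n" using that assms by (simp add: index_set_def)
    then show "(\<lambda>y. y (m, m - k)) \<in> tuple_coords (index_set n)"
      unfolding tuple_coords_def by blast
  qed
  then show ?thesis
    by (cases "k < m") (auto simp: coeff_tuple_poly intro: fraction_on_intros)
qed

text \<open>Forward substitution divides only by the constant coefficients of the
  \<open>g y k\<close>, which \<open>nz\<close> keeps nonzero on all of \<open>X\<close>.\<close>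

lemma fraction_on_triangular_coeff:
  assumes g: "\<And>k j. k \<le> i \<Longrightarrow> fraction_on F X (\<lambda>y. coeff (g y k) j)"
    and R: "\<And>j. fraction_on F X (\<lambda>y. coeff (R y) j)"
    and nz: "\<And>k y. k \<le> i \<Longrightarrow> y \<in> X \<Longrightarrow> coeff (g y k) 0 \<noteq> 0"
  shows "fraction_on F X (\<lambda>y. triangular_coeff (g y) (R y) i)"
  using g nz
proof (induction i rule: less_induct)
  case (less i)
  show ?case
    unfolding triangular_coeff.simps[of _ _ i]
    by (intro fraction_on_divide fraction_on_intros R less) (use less.prems in auto)
qed

lemma fraction_on_coeff_step_defect:
  assumes "m < n"
  shows "fraction_on (tuple_coords (index_set n)) X (\<lambda>y. coeff (step_defect (tuple_poly y) m) k)"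
  unfolding step_defect_def coeff_diff coeff_pCons
  using assms
  by (intro fraction_on_diff; cases k)
    (auto intro!: fraction_on_const fraction_on_coeff_tuple_poly)

lemma fraction_on_block_entry:
  assumes "m < n"
  shows "fraction_on (tuple_coords (index_set n)) (target_space n)
    (\<lambda>y :: _ \<Rightarrow> 'a::field. block_entry (tuple_poly y) m j)"
proof (cases "j < m")
  case True
  \<comment> \<open>Up to sign this is one of the coordinates \<open>y (i, i)\<close>, which vanish
    nowhere on the target.\<close>
  have "coeff (step_defect (tuple_poly y) (m - 1 - k)) 0 \<noteq> 0"
    if "y \<in> target_space n" for k and y :: "nat \<times> nat \<Rightarrow> 'a"
    using admissible_tuple_poly[OF that] assms
    by (simp add: coeff_step_defect_0 admissible_def)
  then show ?thesis
    using True assms unfolding block_entry_def if_P[OF True]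
    by (intro fraction_on_triangular_coeff)
      (auto intro!: fraction_on_intros fraction_on_coeff_step_defect fraction_on_coeff_tuple_poly)
next
  case False
  then show ?thesis
    using assms by (simp add: block_entry_def fraction_on_coeff_step_defect)
qed

lemma variety_morphism_borel_of_tuple:
  "variety_morphism (tuple_coords (index_set n)) (target_space n)
     (mat_coords n) (borel_subgroup n :: 'k::field mat set) (borel_of_tuple n)"
proof (rule variety_morphismI[OF borel_of_tuple_in_borel])
  fix g :: "'k mat \<Rightarrow> 'k" assume "g \<in> mat_coords n"
  then obtain r c where g: "g = (\<lambda>A. A $$ (r, c))" and rc: "r < n" "c < n"
    by (auto simp: mat_coords_def)
  then show "fraction_on (tuple_coords (index_set n)) (target_space n) (\<lambda>y. g (borel_of_tuple n y))"
    by (cases "r < c"; cases "c = 0")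
      (auto simp: borel_of_tuple_def intro!: fraction_on_intros fraction_on_block_entry)
qed

theorem theorem3p3:
  fixes n :: nat
  assumes "n \<ge> 1"
  shows "variety_isomorphism (mat_coords n) (borel_subgroup n)
           (tuple_coords (index_set n)) (target_space n)
           (Pi_map n :: 'k::alg_closed_field mat \<Rightarrow> nat \<times> nat \<Rightarrow> 'k)"
  unfolding variety_isomorphism_def
  using variety_morphism_Pi_map variety_morphism_borel_of_tuple
    borel_of_tuple_Pi_map Pi_map_borel_of_tuple by blast

end
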